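(* Over an alphabet containing at least four distinct characters, there exists a family of strings $T_m$ ($m \geq 1$), with $n = |T_m| \to \infty$, such that the total work of leftward online construction of the CDAWG, i.e. of building $\mathrm{CDAWG}(T_m[i..n])$ for decreasing $i = n, \ldots, 1$, is $\Omega(n^2)$; specifically, $\sum_{i=1}^{n-1} \left| \mathsf{e}(T_m[i..n]) - \mathsf{e}(T_m[i+1..n]) \right| = \Omega(n^2)$.
   Context: Strings are finite sequences of characters from an alphabet $\Sigma$; $\varepsilon$ is the empty string, $T[i..j]=T[i]\cdots T[j]$. For a string $T$, $\mathrm{Substr}(T)$ is its set of substrings (including $\varepsilon$). A substring $u$ of $T$ is left-maximal in $T$ if $u$ is a prefix of $T$ or there are distinct characters $c \neq d$ with $cu, du \in \mathrm{Substr}(T)$; it is right-maximal in $T$ if $u$ is a suffix of $T$ or there are distinct characters $c\neq d$ with $uc, ud \in \mathrm{Substr}(T)$. $\mathsf{M}(T)$ is the set of substrings of $T$ that are both left- and right-maximal (it contains $\varepsilon$ and $T$). The compact directed acyclic word graph $\mathrm{CDAWG}(T)$ has exactly one node for each element of $\mathsf{M}(T)$, and the outgoing edges of the node $x$ are in bijection with the characters $c$ such that $xc \in \mathrm{Substr}(T)$. For a string $w$, $d_T(w)$ is the number of distinct characters $c$ with $wc \in \mathrm{Substr}(T)$. The size of the CDAWG is $\mathsf{e}(T) = \sum_{x \in \mathsf{M}(T)} d_T(x)$, its number of edges. In leftward online construction the CDAWG of $T[i+1..n]$ is updated to the CDAWG of $T[i..n]$; the work of each update is at least the number of edges that must be added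 or removed, which is at least $|\mathsf{e}(T[i..n]) - \mathsf{e}(T[i+1..n])|$. *)

theory Defs
  imports Complex_Main "HOL-Library.Sublist" "HOL-Library.Landau_Symbols"
begin

text \<open>The factor $T[i..j]$ with 1-based positions; it is empty when $j < i$, so
  $T[n+1..n] = \varepsilon$ for $n = |T|$.\<close>

definition factor :: "'a list \<Rightarrow> nat \<Rightarrow> nat \<Rightarrow> 'a list" where
  "factor T i j = take (Suc j - i) (drop (i - 1) T)"

definition Substr :: "'a list \<Rightarrow> 'a list set" where
  "Substr T = {u. sublist u T}"

definition left_maximal :: "'a list \<Rightarrow> 'a list \<Rightarrow> bool" where
  "left_maximal T u \<longleftrightarrow> u \<in> Substr T \<and>
     (prefix u T \<or> (\<exists>c d. c \<noteq> d \<and> c # u \<in> Substr T \<and> d # u \<in> Substr T))"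

definition right_maximal :: "'a list \<Rightarrow> 'a list \<Rightarrow> bool" where
  "right_maximal T u \<longleftrightarrow> u \<in> Substr T \<and>
     (suffix u T \<or> (\<exists>c d. c \<noteq> d \<and> u @ [c] \<in> Substr T \<and> u @ [d] \<in> Substr T))"

definition maximal_substrs :: "'a list \<Rightarrow> 'a list set" where
  "maximal_substrs T = {u. left_maximal T u \<and> right_maximal T u}"

definition out_degree :: "'a list \<Rightarrow> 'a list \<Rightarrow> nat" where
  "out_degree T w = card {c. w @ [c] \<in> Substr T}"

text \<open>The number of edges of $\mathrm{CDAWG}(T)$: its nodes are the elements of
  \<^term>\<open>maximal_substrs T\<close>, and the edges leaving the node \<^term>\<open>x\<close> correspond to the
  characters \<^term>\<open>c\<close> with \<^term>\<open>x @ [c] \<in> Substr T\<close>.\<close>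

definition cdawg_size :: "'a list \<Rightarrow> nat" where
  "cdawg_size T = (\<Sum>x\<in>maximal_substrs T. out_degree T x)"

text \<open>The change $|e(T[i..n]) - e(T[i+1..n])|$, $n = |T|$, in the number of edges when the
  CDAWG of $T[i+1..n]$ is updated to that of $T[i..n]$.\<close>

definition size_change :: "'a list \<Rightarrow> nat \<Rightarrow> int" where
  "size_change T i =
     \<bar>int (cdawg_size (factor T i (length T))) - int (cdawg_size (factor T (i + 1) (length T)))\<bar>"

text \<open>\<^term>\<open>W T i\<close> is the work spent on updating the CDAWG of $T[i+1..n]$ to that of
  $T[i..n]$. The only property of the construction procedure that is assumed is that an update
  costs at least the number of edges that have to be added or removed, hence at least
  \<^term>\<open>size_change T i\<close>. The step $i = n$ builds the CDAWG of $T[n..n]$ from scratch; its work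
  is only assumed to be nonnegative.\<close>

definition leftward_update_work :: "('a list \<Rightarrow> nat \<Rightarrow> nat) \<Rightarrow> bool" where
  "leftward_update_work W \<longleftrightarrow>
     (\<forall>T i. 1 \<le> i \<and> i < length T \<longrightarrow> size_change T i \<le> int (W T i))"

end

theory Submission
  imports Defs
begin

text \<open>
  Let \<open>T = (ab)\<^sup>m c b (ab)\<^sup>m\<close> and consider its suffix \<open>U = (ab)\<^sup>k c b (ab)\<^sup>m\<close> with \<open>k < m\<close>. The words
  \<open>(ab)\<^sup>j\<close> with \<open>1 \<le> j \<le> k\<close> are maximal in \<open>U\<close>: they are prefixes of \<open>U\<close>, and both \<open>a\<close> and \<open>c\<close> can
  follow them. In \<open>b U\<close> every \<open>a\<close> is preceded by \<open>b\<close>, so they all cease to be left-maximal.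
  On the other hand, prepending one character creates at most two new nodes, namely the whole
  word and the longest prefix of \<open>b U\<close> that occurs in \<open>U\<close>, here \<open>b (ab)\<^sup>k\<close>; this prefix is also
  the only old word that may gain an outgoing edge. Hence each such step loses at least \<open>k - 3\<close>
  edges, and summing over \<open>k\<close> gives a quadratic total.
\<close>

section \<open>Finiteness and monotonicity of substrings and maximality\<close>

lemma prefix_sublist_trans: "prefix u v \<Longrightarrow> sublist v T \<Longrightarrow> sublist u T"
  using prefix_imp_sublist sublist_order.order.trans by blast

lemma suffix_sublist_trans: "suffix u v \<Longrightarrow> sublist v T \<Longrightarrow> sublist u T"
  using suffix_imp_sublist sublist_order.order.trans by blast

lemma finite_Substr: "finite (Substr T)"
proof (rule finite_subset)
  show "Substr T \<subseteq> {u. set u \<subseteq> set T \<and> length u \<le> length T}"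
    by (auto simp: Substr_def dest: set_mono_sublist sublist_length_le)
  show "finite {u. set u \<subseteq> set T \<and> length u \<le> length T}"
    by (rule finite_lists_length_le) simp
qed

lemma finite_maximal_substrs: "finite (maximal_substrs T)"
  by (rule finite_subset[OF _ finite_Substr[of T]])
     (auto simp: maximal_substrs_def left_maximal_def)

lemma extensions_subset: "{c. w @ [c] \<in> Substr T} \<subseteq> set T"
  by (auto simp: Substr_def dest: set_mono_sublist)

lemma out_degree_self: "out_degree T T = 0"
proof -
  have "T @ [y] \<notin> Substr T" for y
    using sublist_length_le[of "T @ [y]" T] by (auto simp: Substr_def)
  thus ?thesis by (simp add: out_degree_def)
qed

lemma left_maximal_prefix:
  assumes "left_maximal T w" "prefix v w"
  shows "left_maximal T v"
proof -
  have "sublist v T"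
    using assms prefix_sublist_trans by (auto simp: left_maximal_def Substr_def)
  moreover have "sublist (y # v) T" if "sublist (y # w) T" for y
    using that assms(2) prefix_sublist_trans[of "y # v" "y # w"] by simp
  ultimately show ?thesis
    using assms unfolding left_maximal_def Substr_def
    using prefix_order.order_trans by blast
qed

section \<open>Effect of prepending one character on nodes and edges\<close>

locale prepend =
  fixes x z :: 'a and U w :: "'a list"
  assumes w_occurs: "sublist w U"
    and wz_prefix: "prefix (w @ [z]) (x # U)"
    and wz_new: "\<not> sublist (w @ [z]) U"
begin

text \<open>Prefixes of one word are comparable, and \<open>z\<close> makes the prefix one letter
  longer than \<open>w\<close> new; so \<open>w\<close> is the longest prefix of
  \<open>x # U\<close> that occurs in \<open>U\<close>.\<close>

lemma old_prefix:
  assumes "prefix u (x # U)" "sublist u U"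
  shows "prefix u w"
proof (rule ccontr)
  assume "\<not> prefix u w"
  hence "prefix (w @ [z]) u"
    using assms(1) wz_prefix prefix_same_cases[of u "x # U" "w @ [z]"] by auto
  thus False
    using assms(2) wz_new prefix_sublist_trans by blast
qed

text \<open>A substring of \<open>x # U\<close> missing from \<open>U\<close> must be a prefix of
  \<open>x # U\<close>. If \<open>u @ [y]\<close> were one, the old prefix \<open>u\<close> would be
  strictly shorter than \<open>w\<close>, so \<open>u @ [y]\<close> would lie inside
  \<open>w\<close> and be old after all.\<close>

lemma old_extension:
  assumes "sublist u U" "u \<noteq> w" "sublist (u @ [y]) (x # U)"
  shows "sublist (u @ [y]) U"
proof (rule ccontr)
  assume new: "\<not> sublist (u @ [y]) U"
  hence pre: "prefix (u @ [y]) (x # U)"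
    using assms(3) by (simp add: sublist_Cons_right)
  hence "prefix u w"
    using old_prefix assms(1) append_prefixD by blast
  hence "length (u @ [y]) \<le> length w"
    using assms(2) by (auto simp: prefix_def Suc_le_eq)
  moreover have "prefix w (x # U)"
    using wz_prefix by (rule append_prefixD)
  ultimately have "prefix (u @ [y]) w"
    using pre by (metis prefix_length_prefix)
  thus False
    using new w_occurs prefix_sublist_trans by blast
qed

lemma out_degree_prepend:
  assumes "sublist u U" "u \<noteq> w"
  shows "out_degree (x # U) u = out_degree U u"
proof -
  have "{y. u @ [y] \<in> Substr (x # U)} = {y. u @ [y] \<in> Substr U}"
    using old_extension[OF assms] by (auto simp: Substr_def sublist_Cons_right)
  thus ?thesis by (simp add: out_degree_def)
qed

lemma maximal_substrs_prepend:
  assumes lm: "left_maximal U w"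
  shows "maximal_substrs (x # U) \<subseteq> insert w (insert (x # U) (maximal_substrs U))"
proof
  fix u assume u: "u \<in> maximal_substrs (x # U)"
  have "u \<in> maximal_substrs U" if ne: "u \<noteq> w" "u \<noteq> x # U"
  proof -
    have suf: "suffix u U" if "suffix u (x # U)"
      using that ne by (simp add: suffix_Cons)
    have occ: "sublist u U"
    proof (rule ccontr)
      assume new: "\<not> sublist u U"
      hence "\<not> suffix u (x # U)" using suf suffix_imp_sublist by blast
      then obtain y y' where y: "y \<noteq> y'" "sublist (u @ [y]) (x # U)" "sublist (u @ [y']) (x # U)"
        using u by (auto simp: maximal_substrs_def right_maximal_def Substr_def)
      \<comment> \<open>Extensions of a new word are new, hence prefixes of \<open>x # U\<close>;
        two of equal length coincide.\<close>
      have "\<not> sublist (u @ [v]) U" for v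
        using new prefix_sublist_trans[of u "u @ [v]" U] by auto
      hence "prefix (u @ [y]) (x # U)" "prefix (u @ [y']) (x # U)"
        using y by (simp_all add: sublist_Cons_right)
      hence "u @ [y] = u @ [y']"
        by (metis length_append_singleton prefix_length_prefix prefix_order.antisym order_refl)
      with y show False by simp
    qed
    have "right_maximal U u"
      using u suf occ old_extension[OF occ ne(1)]
      unfolding maximal_substrs_def right_maximal_def Substr_def by blast
    moreover have "left_maximal U u"
    proof (cases "prefix u (x # U)")
      case True
      thus ?thesis using old_prefix occ left_maximal_prefix[OF lm] by blast
    next
      case False
      then obtain y y' where y: "y \<noteq> y'" "sublist (y # u) (x # U)" "sublist (y' # u) (x # U)"
        using u by (auto simp: maximal_substrs_def left_maximal_def Substr_def)
      \<comment> \<open>Either both left extensions already occur in \<open>U\<close>, or one of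
        them is a prefix of \<open>x # U\<close>, and then \<open>u\<close> is a prefix of
        \<open>U\<close>.\<close>
      thus ?thesis using occ
        by (auto simp: left_maximal_def Substr_def sublist_Cons_right)
    qed
    ultimately show ?thesis by (simp add: maximal_substrs_def)
  qed
  thus "u \<in> insert w (insert (x # U) (maximal_substrs U))" by blast
qed

lemma cdawg_size_prepend:
  assumes lm: "left_maximal U w"
    and N: "N \<subseteq> maximal_substrs U - maximal_substrs (x # U)"
    and deg: "\<And>u. u \<in> N \<Longrightarrow> 1 \<le> out_degree U u"
  shows "card N + cdawg_size (x # U) \<le> cdawg_size U + out_degree (x # U) w"
proof -
  let ?M = "maximal_substrs (x # U)" and ?d = "out_degree (x # U)"
  \<comment> \<open>These nodes are old and keep their out-degree. Of the two nodes set aside,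
    \<open>x # U\<close> has no outgoing edge, so only the degree of \<open>w\<close> enters the
    bound.\<close>
  let ?R = "?M - {w, x # U}"
  have fin: "finite ?M" "finite (maximal_substrs U)" by (rule finite_maximal_substrs)+
  have finN: "finite N" using N fin(2) finite_subset by blast
  have sub: "?R \<subseteq> maximal_substrs U" using maximal_substrs_prepend[OF lm] by blast
  have "cdawg_size (x # U) \<le> sum ?d (?R \<union> {w, x # U})"
    unfolding cdawg_size_def using fin by (intro sum_mono2) auto
  also have "\<dots> = sum ?d ?R + sum ?d {w, x # U}"
    using fin by (intro sum.union_disjoint) auto
  also have "sum ?d {w, x # U} = ?d w"
    by (cases "w = x # U") (simp_all add: out_degree_self)
  also have "sum ?d ?R = sum (out_degree U) ?R"
    using sub by (intro sum.cong refl out_degree_prepend)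
      (auto simp: maximal_substrs_def left_maximal_def Substr_def)
  finally have 1: "cdawg_size (x # U) \<le> sum (out_degree U) ?R + ?d w" .
  have "card N + sum (out_degree U) ?R \<le> sum (out_degree U) N + sum (out_degree U) ?R"
    using sum_mono[of N "\<lambda>_. 1" "out_degree U"] deg by simp
  also have "\<dots> = sum (out_degree U) (N \<union> ?R)"
    using N fin finN by (intro sum.union_disjoint[symmetric]) auto
  also have "\<dots> \<le> cdawg_size U"
    unfolding cdawg_size_def using N sub fin by (intro sum_mono2) auto
  finally show ?thesis using 1 by simp
qed

end

section \<open>The words with two runs of \<open>ab\<close>\<close>

definition rep2 :: "'a \<Rightarrow> 'a \<Rightarrow> nat \<Rightarrow> 'a list" where
  "rep2 a b k = concat (replicate k [a, b])"

lemma rep2_0 [simp]: "rep2 a b 0 = []"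
  and rep2_Suc [simp]: "rep2 a b (Suc k) = a # b # rep2 a b k"
  by (simp_all add: rep2_def)

lemma length_rep2 [simp]: "length (rep2 a b k) = 2 * k"
  by (induction k) simp_all

lemma rep2_add: "rep2 a b (i + j) = rep2 a b i @ rep2 a b j"
  by (simp add: rep2_def replicate_add)

lemma set_rep2: "set (rep2 a b k) \<subseteq> {a, b}"
  by (induction k) auto

lemma prefix_rep2: "i \<le> j \<Longrightarrow> prefix (rep2 a b i) (rep2 a b j)"
  by (metis le_Suc_ex prefixI rep2_add)

lemma suffix_rep2: "i \<le> j \<Longrightarrow> suffix (rep2 a b i) (rep2 a b j)"
  by (metis add.commute le_Suc_ex suffixI rep2_add)

text \<open>For fixed \<open>m\<close> and \<open>k <= m\<close> these are suffixes of
  \<open>two_runs a b c m m\<close>. The \<open>b\<close> after \<open>c\<close> lets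
  \<open>b # rep2 a b k\<close> be preceded by \<open>c\<close> as well as by
  \<open>a\<close>.\<close>

definition two_runs :: "'a \<Rightarrow> 'a \<Rightarrow> 'a \<Rightarrow> nat \<Rightarrow> nat \<Rightarrow> 'a list" where
  "two_runs a b c m k = rep2 a b k @ c # b # rep2 a b m"

lemma length_two_runs [simp]: "length (two_runs a b c m k) = 2 * k + 2 * m + 2"
  by (simp add: two_runs_def)

lemma set_two_runs: "set (two_runs a b c m k) \<subseteq> {a, b, c}"
  using set_rep2[of a b] by (fastforce simp: two_runs_def)

lemma sublist_two_runs:
  assumes "prefix v (c # b # rep2 a b m)"
  shows "sublist v (two_runs a b c m k)"
  using assms unfolding two_runs_def by (rule prefix_sublist_trans) simp

lemma sublist_rep2_two_runs:
  assumes "i \<le> m"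
  shows "sublist (rep2 a b i) (two_runs a b c m k)"
proof -
  have "suffix (rep2 a b m) (two_runs a b c m k)"
    by (simp add: two_runs_def suffix_def)
  thus ?thesis
    by (rule suffix_sublist_trans[OF suffix_rep2[OF assms] suffix_imp_sublist])
qed

text \<open>The leading \<open>b\<close> drives the induction: removing \<open>b\<close> and
  \<open>a\<close> from the front leaves a word of the same shape.\<close>

lemma before_a_in_rep2:
  assumes "a \<noteq> b" "sublist (y # a # v) (b # rep2 a b m)"
  shows "y = b"
  using assms by (induction m) (auto simp: sublist_Cons_right)

lemma before_a_in_two_runs:
  assumes "distinct [a, b, c]" "sublist (y # a # v) (b # two_runs a b c m k)"
  shows "y = b"
  using assms(2)
proof (induction k)
  case 0
  thus ?case using assms(1) before_a_in_rep2[of a b y v m]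
    by (auto simp: two_runs_def sublist_Cons_right)
next
  case (Suc k)
  thus ?case using assms(1)
    by (auto simp: two_runs_def sublist_Cons_right)
qed

lemma rep2_in_maximal_substrs:
  assumes "a \<noteq> c" "j \<le> k" "k < m"
  shows "rep2 a b j \<in> maximal_substrs (two_runs a b c m k)"
    and "1 \<le> out_degree (two_runs a b c m k) (rep2 a b j)"
proof -
  let ?U = "two_runs a b c m k"
  have pre: "prefix (rep2 a b j) ?U"
    unfolding two_runs_def by (rule prefix_prefix) (rule prefix_rep2[OF assms(2)])
  obtain p where "rep2 a b k = p @ rep2 a b j"
    using suffix_rep2[OF assms(2), of a b] by (auto simp: suffix_def)
  hence "?U = p @ (rep2 a b j @ [c]) @ b # rep2 a b m" by (simp add: two_runs_def)
  hence c: "sublist (rep2 a b j @ [c]) ?U" by (metis sublist_appendI)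
  \<comment> \<open>The end of the first run supplies the extension by \<open>c\<close>; the second
    run, longer because \<open>j < m\<close>, supplies the one by \<open>a\<close>.\<close>
  have "rep2 a b (Suc j) = (rep2 a b j @ [a]) @ [b]"
    using rep2_add[of a b j 1] by simp
  moreover have "sublist (rep2 a b (Suc j)) ?U"
    using assms by (intro sublist_rep2_two_runs) simp
  ultimately have a: "sublist (rep2 a b j @ [a]) ?U"
    using prefix_sublist_trans[of "rep2 a b j @ [a]" "rep2 a b (Suc j)"] by (metis prefixI)
  show "rep2 a b j \<in> maximal_substrs ?U"
    using pre a c assms(1) prefix_imp_sublist[OF pre]
    unfolding maximal_substrs_def left_maximal_def right_maximal_def Substr_def by blast
  have "finite {y. rep2 a b j @ [y] \<in> Substr ?U}"
    by (rule finite_subset[OF extensions_subset]) simp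
  moreover have "{y. rep2 a b j @ [y] \<in> Substr ?U} \<noteq> {}"
    using c by (auto simp: Substr_def)
  ultimately show "1 \<le> out_degree ?U (rep2 a b j)"
    by (simp add: out_degree_def Suc_le_eq card_gt_0_iff)
qed

text \<open>For \<open>j > 0\<close> the word starts with \<open>a\<close>, so it is no prefix of a
  word starting with \<open>b\<close>, and \<open>b\<close> is its only left extension.\<close>

lemma rep2_notin_maximal_substrs:
  assumes "distinct [a, b, c]" "0 < j"
  shows "rep2 a b j \<notin> maximal_substrs (b # two_runs a b c m k)"
proof -
  obtain i where "rep2 a b j = a # b # rep2 a b i"
    using assms(2) by (cases j) auto
  moreover have "y = b" if "sublist (y # a # b # rep2 a b i) (b # two_runs a b c m k)" for y
    using before_a_in_two_runs[OF assms(1) that] .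
  ultimately show ?thesis
    using assms(1) unfolding maximal_substrs_def left_maximal_def Substr_def by auto
qed

lemma cdawg_size_two_runs:
  assumes dist: "distinct [a, b, c]" and "k < m"
  shows "k + cdawg_size (b # two_runs a b c m k) \<le> cdawg_size (two_runs a b c m k) + 3"
proof -
  let ?U = "two_runs a b c m k" and ?w = "b # rep2 a b k"
  \<comment> \<open>\<open>a # ?w\<close> is \<open>rep2 a b (Suc k)\<close>, which fits into the
    second run since \<open>k < m\<close>.\<close>
  have "sublist (a # ?w) ?U"
    using sublist_rep2_two_runs[of "Suc k" m a b c k] assms(2) by simp
  moreover have "sublist (c # ?w) ?U"
    using assms(2) by (intro sublist_two_runs) (simp add: prefix_rep2)
  moreover from this have "sublist ?w ?U"
    by (rule suffix_sublist_trans[rotated]) (simp add: suffix_ConsI)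
  ultimately have lm: "left_maximal ?U ?w"
    using dist by (auto simp: left_maximal_def Substr_def)
  interpret prepend b c ?U ?w
  proof
    show "sublist ?w ?U" using lm by (simp add: left_maximal_def Substr_def)
    show "prefix (?w @ [c]) (b # ?U)" by (simp add: two_runs_def)
    \<comment> \<open>The only \<open>c\<close> in \<open>?U\<close> has \<open>2 * k\<close>
      letters before it, one fewer than \<open>?w\<close> has.\<close>
    show "\<not> sublist (?w @ [c]) ?U"
    proof
      assume "sublist (?w @ [c]) ?U"
      then obtain p s where
        "rep2 a b k @ c # b # rep2 a b m = (p @ ?w) @ c # s"
        by (auto simp: sublist_def two_runs_def)
      moreover have "c \<notin> set (rep2 a b k)" "c \<notin> set (b # rep2 a b m)"
        using dist set_rep2[of a b] by auto
      ultimately have "rep2 a b k = p @ ?w"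
        by (metis append_Cons_eq_iff)
      hence "length (rep2 a b k) = length (p @ ?w)" by (rule arg_cong)
      thus False by simp
    qed
  qed
  have "inj_on (rep2 a b) {1..k}"
  proof (rule inj_onI)
    fix i j assume "rep2 a b i = rep2 a b j"
    hence "length (rep2 a b i) = length (rep2 a b j)" by (rule arg_cong)
    thus "i = j" by simp
  qed
  hence "k = card (rep2 a b ` {1..k})" by (simp add: card_image)
  moreover have "card (rep2 a b ` {1..k}) + cdawg_size (b # ?U)
      \<le> cdawg_size ?U + out_degree (b # ?U) ?w"
    using dist rep2_in_maximal_substrs[of a c _ k m b] rep2_notin_maximal_substrs[OF dist] assms(2)
    by (intro cdawg_size_prepend[OF lm]) auto
  \<comment> \<open>The constant 3 is the number of letters used.\<close>
  moreover have "out_degree (b # ?U) ?w \<le> card {a, b, c}"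
    unfolding out_degree_def
    using extensions_subset[of ?w "b # ?U"] set_two_runs[of a b c m k]
    by (intro card_mono) auto
  moreover have "card {a, b, c} \<le> 3" by (simp add: card_insert_if)
  ultimately show ?thesis by linarith
qed

section \<open>Summation over the suffixes and asymptotics\<close>

lemma factor_to_end: "factor T i (length T) = drop (i - 1) T"
  by (simp add: factor_def)

lemma size_change_two_runs:
  assumes dist: "distinct [a, b, c]" and j: "1 \<le> j" "j \<le> m"
  shows "int m - int j - 3 \<le> size_change (two_runs a b c m m) (2 * j)"
proof -
  \<comment> \<open>Dropping \<open>2 * j\<close> letters removes \<open>j\<close> blocks
    \<open>ab\<close> and leaves \<open>?U\<close>; dropping one letter fewer leaves
    \<open>b # ?U\<close>. Since \<open>j >= 1\<close>, the first run of \<open>?U\<close> is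
    shorter than \<open>m\<close>.\<close>
  let ?T = "two_runs a b c m m" and ?U = "two_runs a b c m (m - j)"
  obtain i where i: "j = Suc i" using j(1) by (cases j) auto
  have "?T = rep2 a b i @ a # b # ?U"
    using rep2_add[of a b i "Suc (m - j)"] i j(2) by (simp add: two_runs_def)
  hence "?T = (rep2 a b i @ [a]) @ b # ?U" "?T = (rep2 a b i @ [a, b]) @ ?U" by simp_all
  hence "drop (length (rep2 a b i @ [a])) ?T = b # ?U"
    "drop (length (rep2 a b i @ [a, b])) ?T = ?U" by (metis append_eq_conv_conj)+
  hence "factor ?T (2 * j) (length ?T) = b # ?U" "factor ?T (2 * j + 1) (length ?T) = ?U"
    unfolding factor_to_end by (simp_all add: i)
  moreover have "int (m - j) + int (cdawg_size (b # ?U)) \<le> int (cdawg_size ?U) + 3"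
    using cdawg_size_two_runs[OF dist, of "m - j" m] j by linarith
  ultimately show ?thesis
    unfolding size_change_def using j(2) by simp
qed

lemma total_size_change_two_runs:
  assumes dist: "distinct [a, b, c]"
  defines "T \<equiv> \<lambda>m. two_runs a b c m m"
  shows "int m * (int m - 7) \<le> 2 * (\<Sum>i = 1..length (T m) - 1. size_change (T m) i)"
proof -
  \<comment> \<open>The upper limit \<open>n\<close> is separated from \<open>m\<close> so that
    induction applies; the factor 2 avoids division.\<close>
  have "(\<Sum>j = 1..n. 2 * (int m - int j - 3)) = int n * (2 * int m - int n - 7)" for n
    by (induction n) (simp_all add: algebra_simps)
  hence "int m * (int m - 7) = (\<Sum>j = 1..m. 2 * (int m - int j - 3))" by simp
  also have "\<dots> = 2 * (\<Sum>j = 1..m. int m - int j - 3)" by (simp add: sum_distrib_left)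
  also have "(\<Sum>j = 1..m. int m - int j - 3) \<le> (\<Sum>j = 1..m. size_change (T m) (2 * j))"
    unfolding T_def by (intro sum_mono size_change_two_runs[OF dist]) auto
  also have "\<dots> = sum (size_change (T m)) ((*) 2 ` {1..m})"
    by (subst sum.reindex) (auto simp: inj_on_def)
  \<comment> \<open>The positions not of the form \<open>2 * j\<close> with
    \<open>1 <= j <= m\<close> contribute nonnegative terms.\<close>
  also have "\<dots> \<le> (\<Sum>i = 1..length (T m) - 1. size_change (T m) i)"
    by (intro sum_mono2) (auto simp: T_def size_change_def)
  finally show ?thesis by simp
qed

theorem theorem7:
  fixes Sigma :: "'a set" and a b c d :: 'a
  assumes "distinct [a, b, c, d]" and "{a, b, c, d} \<subseteq> Sigma"
  shows "\<exists>T :: nat \<Rightarrow> 'a list.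
    (\<forall>m\<ge>1. set (T m) \<subseteq> Sigma) \<and>
    filterlim (\<lambda>m. length (T m)) at_top sequentially \<and>
    (\<lambda>m. real_of_int (\<Sum>i = 1..length (T m) - 1. size_change (T m) i))
      \<in> \<Omega>[sequentially](\<lambda>m. real (length (T m)) ^ 2) \<and>
    (\<forall>W. leftward_update_work W \<longrightarrow>
      (\<lambda>m. real (\<Sum>i = 1..length (T m). W (T m) i))
        \<in> \<Omega>[sequentially](\<lambda>m. real (length (T m)) ^ 2))"
proof -
  define T where "T = (\<lambda>m. two_runs a b c m m)"
  let ?S = "\<lambda>m. \<Sum>i = 1..length (T m) - 1. size_change (T m) i"
  have dist: "distinct [a, b, c]" using assms(1) by simp
  have len: "length (T m) = 4 * m + 2" for m by (simp add: T_def)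
  have "set (T m) \<subseteq> Sigma" for m
    using set_two_runs[of a b c m m] assms(2) by (auto simp: T_def)
  moreover have "filterlim (\<lambda>m. length (T m)) at_top sequentially"
    by (rule filterlim_at_top_mono[OF filterlim_ident]) (simp add: len)
  \<comment> \<open>With n = 4m + 2, the bound m(m - 7)/2 grows like n^2/32; the constant 1/100 and
    the threshold 20 leave ample slack.\<close>
  moreover have bound: "1 / 100 * real (length (T m)) ^ 2 \<le> real_of_int (?S m)"
    if "20 \<le> m" for m
  proof -
    have "real_of_int (int m * (int m - 7)) \<le> real_of_int (2 * ?S m)"
      using total_size_change_two_runs[OF dist, of m] unfolding T_def of_int_le_iff .
    hence S: "real m * (real m - 7) \<le> 2 * real_of_int (?S m)" by simp
    have "20 * real m \<le> real m * real m" using that by (intro mult_right_mono) auto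
    moreover have "(4 * real m + 2) ^ 2 = 16 * (real m * real m) + 16 * real m + 4"
      "real m * (real m - 7) = real m * real m - 7 * real m"
      by (simp_all add: power2_eq_square algebra_simps)
    moreover have "20 \<le> real m" using that by simp
    ultimately have "1 / 100 * (4 * real m + 2) ^ 2 \<le> real m * (real m - 7) / 2" by linarith
    moreover have "real (length (T m)) = 4 * real m + 2" by (simp add: len)
    ultimately show ?thesis using S by (simp only:)
  qed
  \<comment> \<open>Stated for any \<open>f\<close> above \<open>?S\<close>, to serve both the size
    changes and the work.\<close>
  have lower: "f \<in> \<Omega>[sequentially](\<lambda>m. real (length (T m)) ^ 2)"
    if "\<And>m. real_of_int (?S m) \<le> f m" for f :: "nat \<Rightarrow> real"
  proof (rule landau_omega.bigI[of "1 / 100"])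
    show "\<forall>\<^sub>F m in sequentially.
        1 / 100 * norm (real (length (T m)) ^ 2) \<le> norm (f m)"
      using eventually_ge_at_top[of "20 :: nat"]
    proof eventually_elim
      case (elim m)
      thus ?case using bound[of m] that[of m] by simp
    qed
  qed simp
  have "(\<lambda>m. real_of_int (?S m)) \<in> \<Omega>[sequentially](\<lambda>m. real (length (T m)) ^ 2)"
    by (rule lower) simp
  moreover have "(\<lambda>m. real (\<Sum>i = 1..length (T m). W (T m) i))
      \<in> \<Omega>[sequentially](\<lambda>m. real (length (T m)) ^ 2)" if W: "leftward_update_work W" for W
  proof (rule lower)
    fix m
    have "?S m \<le> (\<Sum>i = 1..length (T m) - 1. int (W (T m) i))"
      using W len[of m] unfolding leftward_update_work_def by (intro sum_mono) auto
    \<comment> \<open>The extra summand, the initial step i = n, is nonnegative.\<close>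
    also have "\<dots> \<le> (\<Sum>i = 1..length (T m). int (W (T m) i))"
      by (intro sum_mono2) auto
    finally have "?S m \<le> int (\<Sum>i = 1..length (T m). W (T m) i)" by simp
    hence "real_of_int (?S m) \<le> real_of_int (int (\<Sum>i = 1..length (T m). W (T m) i))"
      by (simp only: of_int_le_iff)
    thus "real_of_int (?S m) \<le> real (\<Sum>i = 1..length (T m). W (T m) i)"
      by simp
  qed
  ultimately show ?thesis by blast
qed

end
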